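(* Let $n\ge r\ge 2$ be integers and let $T$ be a tight $r$-tree with $t\le 4$ edges. Then $$\mathrm{ex}_r(n,T)\le\frac{t-1}{r}\binom{n}{r-1}.$$
   Context: An $r$-graph is a (finite) $r$-uniform hypergraph. An $r$-graph $T$ is a tight $r$-tree if its edges can be ordered as $e_1,\dots,e_t$ ($t\ge 1$) so that for each $i\ge 2$ there are a vertex $v\in e_i$ and an index $1\le s\le i-1$ such that $v\notin\bigcup_{j=1}^{i-1}e_j$ and $e_i\setminus\{v\}\subset e_s$. The vertex set of a tight tree is the union of its edges. An $r$-graph $G$ contains $H$ if there is an injection $V(H)\to V(G)$ mapping every edge of $H$ to an edge of $G$. $\mathrm{ex}_r(n,H)$ is the largest $m$ such that there exists an $n$-vertex $r$-graph with $m$ edges that does not contain $H$. *)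

theory Defs
  imports Complex_Main
begin

record 'a hypergraph =
  verts :: "'a set"
  edges :: "'a set set"

definition r_graph :: "nat \<Rightarrow> 'a hypergraph \<Rightarrow> bool" where
  "r_graph r G \<longleftrightarrow> finite (verts G) \<and> (\<forall>e\<in>edges G. e \<subseteq> verts G \<and> card e = r)"

text \<open>The list \<open>es\<close> is 0-based: \<open>es ! 0\<close> is the first edge of the ordering.\<close>

definition tight_tree :: "nat \<Rightarrow> 'a hypergraph \<Rightarrow> bool" where
  "tight_tree r T \<longleftrightarrow>
     r_graph r T \<and> verts T = \<Union>(edges T) \<and>
     (\<exists>es. es \<noteq> [] \<and> distinct es \<and> set es = edges T \<and>
        (\<forall>i. 1 \<le> i \<and> i < length es \<longrightarrow>
           (\<exists>v\<in>es ! i. \<exists>s<i. v \<notin> (\<Union>j<i. es ! j) \<and> es ! i - {v} \<subseteq> es ! s)))"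

definition contains :: "'b hypergraph \<Rightarrow> 'a hypergraph \<Rightarrow> bool" where
  "contains G H \<longleftrightarrow>
     (\<exists>f. inj_on f (verts H) \<and> f ` verts H \<subseteq> verts G \<and> (\<forall>e\<in>edges H. f ` e \<in> edges G))"

text \<open>Host graphs have vertices in \<^typ>\<open>nat\<close>, which covers every finite hypergraph up to
  isomorphism. If \<open>H\<close> has no edges and at most \<open>n\<close> vertices, no host avoids it and the
  value is unspecified.\<close>

definition ex_number :: "nat \<Rightarrow> nat \<Rightarrow> 'a hypergraph \<Rightarrow> nat" where
  "ex_number r n H =
     Max {card (edges G) | G :: nat hypergraph.
            r_graph r G \<and> card (verts G) = n \<and> \<not> contains G H}"

text \<open>For \<open>H\<close> with at least one edge (in particular for tight trees) the maximum is over a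
  finite nonempty set.\<close>

lemma finite_ex_number_set:
  "finite {card (edges G) | G :: nat hypergraph.
             r_graph r G \<and> card (verts G) = n \<and> \<not> contains G H}"
proof (rule finite_subset)
  show "{card (edges G) | G :: nat hypergraph.
           r_graph r G \<and> card (verts G) = n \<and> \<not> contains G H} \<subseteq> {..2 ^ n}"
  proof clarsimp
    fix G :: "nat hypergraph"
    assume G: "r_graph r G"
    then have "edges G \<subseteq> Pow (verts G)" "finite (verts G)"
      by (auto simp: r_graph_def)
    then show "card (edges G) \<le> 2 ^ card (verts G)"
      by (metis card_Pow card_mono finite_Pow_iff)
  qed
qed simp

lemma ex_number_set_nonempty:
  assumes "edges H \<noteq> {}"
  shows "{card (edges G) | G :: nat hypergraph.
             r_graph r G \<and> card (verts G) = n \<and> \<not> contains G H} \<noteq> {}"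
proof -
  let ?G = "\<lparr>verts = {..<n}, edges = {}\<rparr> :: nat hypergraph"
  have "r_graph r ?G \<and> card (verts ?G) = n \<and> \<not> contains ?G H"
    using assms by (auto simp: r_graph_def contains_def)
  then show ?thesis by blast
qed

end

theory Submission
  imports Defs
begin

text \<open>
  Let \<open>\<partial>G\<close> be the family of \<open>(r - 1)\<close>-sets contained in an edge of \<open>G\<close>. The stronger bound
  \<open>r |G| \<le> (t - 1) |\<partial>G|\<close> holds for every \<open>T\<close>-free \<open>G\<close>.

  A tight tree with at most four edges consists of a common part \<open>S\<close> joined to the edges of one of
  six small \<open>k\<close>-uniform patterns, \<open>k \<le> 3\<close>. Thus \<open>G\<close> is \<open>T\<close>-free iff the link of every
  \<open>(r - k)\<close>-set is pattern-free, and the bound for \<open>G\<close> follows by averaging the bounds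
  \<open>k |L| \<le> (t - 1) |\<partial>L|\<close> over all links \<open>L\<close>.

  In the \<open>k\<close>-uniform case, a counterexample contains a minimal one, \<open>K\<close>. By minimality every member of
  \<open>\<partial>K\<close> lies in at least two edges. Writing \<open>d f\<close> for the number of edges containing \<open>f\<close>, the sum of
  \<open>1 / d f\<close> over all pairs \<open>f \<subset> e\<close> is \<open>|\<partial>K|\<close>, so some edge has sides of large degree. Around that
  edge one finds the pattern, or (for the tight path) three edges at a common vertex whose removal
  contradicts minimality.
\<close>

section \<open>Shadows, links and embeddings of patterns\<close>

definition shadow :: "'a set set \<Rightarrow> 'a set set" where
  "shadow H = {e - {x} | e x. e \<in> H \<and> x \<in> e}"

definition nbrs :: "'a set set \<Rightarrow> 'a set \<Rightarrow> 'a set" where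
  "nbrs H f = {x. x \<notin> f \<and> insert x f \<in> H}"

definition link :: "'a set set \<Rightarrow> 'a set \<Rightarrow> 'a set set" where
  "link H S = {A. A \<inter> S = {} \<and> S \<union> A \<in> H}"

definition uniform :: "nat \<Rightarrow> 'a set set \<Rightarrow> bool" where
  "uniform k H \<longleftrightarrow> finite H \<and> (\<forall>e\<in>H. finite e \<and> card e = k)"

definition embeds :: "nat set set \<Rightarrow> 'a set set \<Rightarrow> bool" where
  "embeds P H \<longleftrightarrow> (\<exists>g. inj_on g (\<Union>P) \<and> (\<forall>A\<in>P. g ` A \<in> H))"

text \<open>The size of \<open>S\<close> is left open; when \<open>E\<close> is the edge set of an
  \<open>r\<close>-graph, \<open>cone_uniformity\<close> recovers it.\<close>

definition is_cone :: "nat set set \<Rightarrow> 'a set set \<Rightarrow> bool" where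
  "is_cone P E \<longleftrightarrow>
     (\<exists>S g. inj_on g (\<Union>P) \<and> S \<inter> g ` \<Union>P = {} \<and> E = (\<lambda>A. S \<union> g ` A) ` P)"

text \<open>The patterns: \<open>tree_core k t P\<close> for a \<open>k\<close>-uniform \<open>P\<close> with \<open>t\<close> edges.\<close>

inductive tree_core :: "nat \<Rightarrow> nat \<Rightarrow> nat set set \<Rightarrow> bool" where
  star: "1 \<le> t \<Longrightarrow> tree_core 1 t ((\<lambda>i. {i}) ` {..<t})"
| path3: "tree_core 2 3 {{0,1},{1,2},{2,3}}"
| fork: "tree_core 2 4 {{0,1},{0,2},{0,3},{1,4}}"
| path4: "tree_core 2 4 {{0,1},{1,2},{2,3},{3,4}}"
| triangle: "tree_core 3 4 {{0,1,2},{0,1,3},{1,2,4},{0,2,5}}"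
| tight_path: "tree_core 3 4 {{0,1,2},{1,2,3},{2,3,4},{3,4,5}}"

subsection \<open>Critical families\<close>

lemma shadow_mono: "H \<subseteq> K \<Longrightarrow> shadow H \<subseteq> shadow K"
  by (auto simp: shadow_def)

lemma shadow_eq_image: "shadow H = (\<lambda>(e, x). e - {x}) ` Sigma H (\<lambda>e. e)"
  by (auto simp: shadow_def image_iff)

lemma finite_shadow: "uniform k H \<Longrightarrow> finite (shadow H)"
  unfolding shadow_eq_image uniform_def by (intro finite_imageI finite_SigmaI) auto

lemma finite_nbrs: "uniform k H \<Longrightarrow> finite (nbrs H f)"
proof -
  assume H: "uniform k H"
  have "nbrs H f \<subseteq> \<Union>H" by (auto simp: nbrs_def)
  then show ?thesis using H finite_subset unfolding uniform_def by blast
qed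

lemma uniform_subset: "uniform k H \<Longrightarrow> K \<subseteq> H \<Longrightarrow> uniform k K"
  unfolding uniform_def using finite_subset by blast

lemma embeds_mono: "embeds P K \<Longrightarrow> K \<subseteq> H \<Longrightarrow> embeds P H"
  unfolding embeds_def by blast

text \<open>Lets a copy of a pattern be exhibited as a vertex list, entry \<open>i\<close> (from 0)
  being the image of \<open>i\<close>.\<close>

lemma embeds_list:
  assumes "distinct xs" "\<forall>A\<in>P. \<forall>i\<in>A. i < length xs" "\<forall>A\<in>P. (!) xs ` A \<in> H"
  shows "embeds P H"
  unfolding embeds_def using assms
  by (intro exI[of _ "(!) xs"] conjI inj_on_nth) auto

definition critical :: "nat \<Rightarrow> nat \<Rightarrow> 'a set set \<Rightarrow> bool" where
  "critical k d K \<longleftrightarrow> uniform k K \<and> d * card (shadow K) < k * card K \<and>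
     (\<forall>F. F \<subseteq> K \<longrightarrow> F \<noteq> {} \<longrightarrow> k * card (K - F) \<le> d * card (shadow (K - F)))"

lemma critical_subfamily:
  assumes "uniform k H" "d * card (shadow H) < k * card H"
  obtains K where "K \<subseteq> H" "critical k d K"
proof -
  let ?P = "\<lambda>K. K \<subseteq> H \<and> d * card (shadow K) < k * card K"
  obtain K where K: "?P K" and least: "\<And>L. ?P L \<Longrightarrow> card K \<le> card L"
    using ex_has_least_nat[of ?P H card] assms by auto
  have fin: "finite K" using K assms(1) finite_subset unfolding uniform_def by auto
  have "k * card (K - F) \<le> d * card (shadow (K - F))" if "F \<subseteq> K" "F \<noteq> {}" for F
  proof (rule ccontr)
    assume "\<not> ?thesis"
    then have "card K \<le> card (K - F)" using K by (intro least) auto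
    moreover have "card (K - F) < card K"
      using that fin by (intro psubset_card_mono) auto
    ultimately show False by simp
  qed
  then show thesis using K uniform_subset[OF assms(1)] by (intro that[of K]) (auto simp: critical_def)
qed

text \<open>\<open>K\<close> violates the bound and \<open>K - F\<close> satisfies it, so deleting
  \<open>F\<close> lowers \<open>k * card K\<close> by more than it lowers
  \<open>d * card (shadow K)\<close>, and the latter drops by at least
  \<open>d * card M\<close>.\<close>

lemma critical_removal:
  assumes "critical k d K" "F \<subseteq> K" "F \<noteq> {}" "M \<subseteq> shadow K" "M \<inter> shadow (K - F) = {}"
  shows "d * card M < k * card F"
proof -
  have fin: "finite (shadow K)" "finite K"
    using assms(1) finite_shadow by (auto simp: critical_def uniform_def)
  have "M \<union> shadow (K - F) \<subseteq> shadow K" using assms(4) shadow_mono[of "K - F" K] by auto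
  then have "card M + card (shadow (K - F)) \<le> card (shadow K)"
    using assms(5) fin by (metis card_Un_disjoint card_mono finite_Un finite_subset)
  then have "d * card M + d * card (shadow (K - F)) \<le> d * card (shadow K)"
    by (metis distrib_left mult_le_mono2)
  also have "\<dots> < k * card K" using assms(1) by (simp add: critical_def)
  also have "k * card K = k * card (K - F) + k * card F"
    using card_Diff_subset[of F K] card_mono[of K F] assms(2) fin finite_subset
    by (metis distrib_left le_add_diff_inverse2)
  also have "k * card (K - F) \<le> d * card (shadow (K - F))"
    using assms(1-3) by (simp add: critical_def)
  finally show ?thesis by simp
qed

text \<open>If \<open>f\<close> lay in a single edge, deleting that edge would remove
  \<open>f\<close> from the shadow, and \<open>critical_removal\<close> would give
  \<open>d < k\<close>.\<close>

lemma critical_second_nbr: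
  assumes K: "critical k d K" and "k \<le> d" "x \<notin> f" "insert x f \<in> K"
  shows "\<exists>y. y \<noteq> x \<and> y \<notin> f \<and> insert y f \<in> K"
proof -
  let ?e = "insert x f"
  have "f = ?e - {x}" using assms(3) by auto
  then have "f \<in> shadow K" using assms(4) unfolding shadow_def by blast
  moreover have "\<not> d * card {f} < k * card {?e}" using assms(2) by simp
  ultimately have "{f} \<inter> shadow (K - {?e}) \<noteq> {}"
    using critical_removal[OF K, of "{?e}" "{f}"] assms(4) by blast
  then obtain e y where "e \<in> K" "e \<noteq> ?e" "y \<in> e" "f = e - {y}"
    by (auto simp: shadow_def)
  then show ?thesis by (intro exI[of _ y]) (auto simp: insert_absorb)
qed

text \<open>Double counting: the pairs \<open>(e, x)\<close> are regrouped by the side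
  \<open>f = e - {x}\<close>, and the \<open>card (nbrs K f)\<close> pairs over \<open>f\<close>
  have total weight 1.\<close>

lemma sum_inverse_codegrees:
  assumes "uniform k K"
  shows "(\<Sum>e\<in>K. \<Sum>x\<in>e. 1 / real (card (nbrs K (e - {x})))) = real (card (shadow K))"
proof -
  have fin: "finite K" "\<And>e. e \<in> K \<Longrightarrow> finite e" using assms by (auto simp: uniform_def)
  have "(\<Sum>e\<in>K. \<Sum>x\<in>e. 1 / real (card (nbrs K (e - {x})))) =
        (\<Sum>(e, x)\<in>Sigma K (\<lambda>e. e). 1 / real (card (nbrs K (e - {x}))))"
    using fin by (intro sum.Sigma) auto
  also have "\<dots> = (\<Sum>(f, x)\<in>Sigma (shadow K) (nbrs K). 1 / real (card (nbrs K f)))"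
    by (rule sum.reindex_bij_witness[of _ "\<lambda>(f, x). (insert x f, x)" "\<lambda>(e, x). (e - {x}, x)"])
       (auto simp: shadow_def nbrs_def insert_absorb)
  also have "\<dots> = (\<Sum>f\<in>shadow K. \<Sum>x\<in>nbrs K f. 1 / real (card (nbrs K f)))"
    using finite_shadow[OF assms] finite_nbrs[OF assms] by (intro sum.Sigma[symmetric]) auto
  also have "\<dots> = (\<Sum>f\<in>shadow K. 1)"
  proof (rule sum.cong)
    fix f assume "f \<in> shadow K"
    then have "nbrs K f \<noteq> {}" by (fastforce simp: shadow_def nbrs_def insert_absorb)
    then show "(\<Sum>x\<in>nbrs K f. 1 / real (card (nbrs K f))) = 1"
      using finite_nbrs[OF assms] by simp
  qed simp
  finally show ?thesis by simp
qed

text \<open>Averaging: \<open>d\<close> times the total weight is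
  \<open>d * card (shadow K)\<close>, which is below \<open>k\<close> per edge.\<close>

lemma critical_light_edge:
  assumes "critical k d K"
  obtains e where "e \<in> K" "real d * (\<Sum>x\<in>e. 1 / real (card (nbrs K (e - {x})))) < real k"
proof -
  let ?w = "\<lambda>e. \<Sum>x\<in>e. 1 / real (card (nbrs K (e - {x})))"
  have u: "uniform k K" and lt: "d * card (shadow K) < k * card K"
    using assms by (auto simp: critical_def)
  have "\<exists>e\<in>K. real d * ?w e < real k"
  proof (rule ccontr)
    assume "\<not> ?thesis"
    then have "(\<Sum>e\<in>K. real k) \<le> (\<Sum>e\<in>K. real d * ?w e)" by (intro sum_mono) (auto simp: not_less)
    also have "\<dots> = real d * real (card (shadow K))"
      unfolding sum_inverse_codegrees[OF u, symmetric] by (simp add: sum_distrib_left)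
    finally have "real (k * card K) \<le> real (d * card (shadow K))" by (simp add: mult.commute)
    then show False using lt by linarith
  qed
  then show thesis using that by blast
qed

text \<open>Were all \<open>k\<close> codegrees at most \<open>d\<close>, each summand times
  \<open>d\<close> would be at least 1 and the sum at least \<open>k\<close>.\<close>

lemma light_edge_heavy_side:
  assumes "uniform k K" "e \<in> K"
    and "real d * (\<Sum>x\<in>e. 1 / real (card (nbrs K (e - {x})))) < real k"
  obtains x where "x \<in> e" "d < card (nbrs K (e - {x}))"
proof -
  have "\<exists>x\<in>e. d < card (nbrs K (e - {x}))"
  proof (rule ccontr)
    assume neg: "\<not> ?thesis"
    have "1 \<le> real d / real (card (nbrs K (e - {x})))" if "x \<in> e" for x
    proof -
      have "x \<in> nbrs K (e - {x})" using that assms(2) by (auto simp: nbrs_def insert_absorb)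
      \<comment> \<open>Positivity matters here, since a quotient by 0 is 0 in HOL.\<close>
      then have "0 < card (nbrs K (e - {x}))"
        using finite_nbrs[OF assms(1)] card_gt_0_iff by blast
      moreover have "card (nbrs K (e - {x})) \<le> d" using neg that by auto
      ultimately show ?thesis by simp
    qed
    then have "(\<Sum>x\<in>e. 1) \<le> (\<Sum>x\<in>e. real d / real (card (nbrs K (e - {x}))))"
      by (intro sum_mono)
    then show False using assms by (simp add: uniform_def sum_distrib_left)
  qed
  then show thesis using that by blast
qed

lemma obtain_avoiding:
  assumes "card (set xs) < card A"
  obtains y where "y \<in> A" "y \<notin> set xs"
  using assms by (metis List.finite_set card_mono not_less subsetI)

subsection \<open>Stars and graphs\<close>

text \<open>For \<open>k = 1\<close> the only side of an edge is the empty set, whose neighbours are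
  the vertices of the singleton edges.\<close>

lemma critical_star:
  assumes K: "critical 1 d K"
  shows "embeds ((\<lambda>i. {i}) ` {..<Suc d}) K"
proof -
  have u: "uniform 1 K" using K by (simp add: critical_def)
  obtain e x where e: "e \<in> K" "x \<in> e" "d < card (nbrs K (e - {x}))"
    using critical_light_edge[OF K] light_edge_heavy_side[OF u] by metis
  have "e - {x} = {}" using u e by (auto simp: uniform_def card_1_singleton_iff)
  then have "d < card (nbrs K {})" using e(3) by metis
  then have "card {..<Suc d} \<le> card (nbrs K {})" by simp
  then obtain g where g: "inj_on g {..<Suc d}" "g ` {..<Suc d} \<subseteq> nbrs K {}"
    using card_le_inj[of "{..<Suc d}" "nbrs K {}"] finite_nbrs[OF u] by auto
  then show ?thesis unfolding embeds_def
    by (intro exI[of _ g]) (auto simp: nbrs_def)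
qed

text \<open>Criticality for graphs in usable form: a vertex of degree above \<open>d\<close>, no
  loops, no vertex of degree 1.\<close>

lemma critical_graph:
  assumes K: "critical 2 d K" and "2 \<le> d"
  obtains v where "Suc d \<le> card {x. {v, x} \<in> K}"
    "\<And>a b. {a, b} \<in> K \<Longrightarrow> a \<noteq> b"
    "\<And>a b. {a, b} \<in> K \<Longrightarrow> \<exists>c. c \<noteq> a \<and> {b, c} \<in> K"
proof -
  have u: "uniform 2 K" using K by (simp add: critical_def)
  have ne: "a \<noteq> b" if "{a, b} \<in> K" for a b using u that by (force simp: uniform_def)
  obtain e x where e: "e \<in> K" "x \<in> e" "d < card (nbrs K (e - {x}))"
    using critical_light_edge[OF K] light_edge_heavy_side[OF u] by metis
  have "card (e - {x}) = 1" using u e by (simp add: uniform_def)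
  then obtain v where v: "e - {x} = {v}" by (auto simp: card_1_singleton_iff)
  have "nbrs K {v} = {x. {v, x} \<in> K}" using ne by (auto simp: nbrs_def insert_commute)
  then have "Suc d \<le> card {x. {v, x} \<in> K}" using e v by simp
  moreover have "\<exists>c. c \<noteq> a \<and> {b, c} \<in> K" if "{a, b} \<in> K" for a b
    using critical_second_nbr[OF K assms(2), of a "{b}"] ne[OF that] that
    by (auto simp: insert_commute)
  ultimately show thesis using that ne by blast
qed

text \<open>The path is \<open>w x v y\<close>: the edge \<open>v x\<close> continues to
  \<open>w\<close>, and degree 3 at \<open>v\<close> leaves a neighbour \<open>y\<close> outside
  \<open>{x, w}\<close>.\<close>

lemma critical_path3:
  assumes "critical 2 2 K"
  shows "embeds {{0,1},{1,2},{2,3}} K"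
proof -
  obtain v where v: "Suc 2 \<le> card {x. {v, x} \<in> K}"
    and ne: "\<And>a b. {a, b} \<in> K \<Longrightarrow> a \<noteq> b"
    and nxt: "\<And>a b. {a, b} \<in> K \<Longrightarrow> \<exists>c. c \<noteq> a \<and> {b, c} \<in> K"
    using critical_graph[OF assms] by auto
  obtain x where x: "{v, x} \<in> K"
    using obtain_avoiding[of "[]" "{x. {v, x} \<in> K}"] v by auto
  obtain w where w: "w \<noteq> v" "{x, w} \<in> K" using nxt x by blast
  have "card (set [x, w]) < card {x. {v, x} \<in> K}"
    using v card_length[of "[x, w]"] by simp
  then obtain y where y: "{v, y} \<in> K" "y \<notin> set [x, w]" using obtain_avoiding by blast
  show ?thesis
    by (rule embeds_list[of "[w, x, v, y]"])
       (use x w y ne in \<open>auto simp: insert_commute\<close>)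
qed

text \<open>The centre is \<open>v\<close>, the long leg is \<open>v x w\<close>, and degree 4
  leaves two leaves \<open>y\<close>, \<open>z\<close> away from \<open>x\<close> and
  \<open>w\<close>.\<close>

lemma critical_fork:
  assumes "critical 2 3 K"
  shows "embeds {{0,1},{0,2},{0,3},{1,4}} K"
proof -
  obtain v where v: "Suc 3 \<le> card {x. {v, x} \<in> K}"
    and ne: "\<And>a b. {a, b} \<in> K \<Longrightarrow> a \<noteq> b"
    and nxt: "\<And>a b. {a, b} \<in> K \<Longrightarrow> \<exists>c. c \<noteq> a \<and> {b, c} \<in> K"
    using critical_graph[OF assms] by auto
  obtain x where x: "{v, x} \<in> K"
    using obtain_avoiding[of "[]" "{x. {v, x} \<in> K}"] v by auto
  obtain w where w: "w \<noteq> v" "{x, w} \<in> K" using nxt x by blast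
  have "card (set [x, w]) < card {x. {v, x} \<in> K}"
    using v card_length[of "[x, w]"] by simp
  then obtain y where y: "{v, y} \<in> K" "y \<notin> set [x, w]" using obtain_avoiding by blast
  have "card (set [x, w, y]) < card {x. {v, x} \<in> K}"
    using v card_length[of "[x, w, y]"] by simp
  then obtain z where z: "{v, z} \<in> K" "z \<notin> set [x, w, y]" using obtain_avoiding by blast
  show ?thesis
    by (rule embeds_list[of "[v, x, y, z, w]"])
       (use x w y z ne in \<open>auto simp: insert_commute\<close>)
qed

text \<open>In a path-free \<open>K\<close>, stepping from a neighbour of \<open>v\<close> to a
  vertex other than \<open>v\<close> stays among the neighbours of \<open>v\<close>. An edge
  \<open>x1 x2\<close> found this way, an edge \<open>x3 x4\<close> at another neighbour
  \<open>x3\<close> and a spare neighbour \<open>x5\<close> give a path in every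
  configuration.\<close>

lemma critical_path4:
  assumes "critical 2 3 K"
  shows "embeds {{0,1},{1,2},{2,3},{3,4}} K"
proof (rule ccontr)
  assume free: "\<not> ?thesis"
  obtain v where v: "Suc 3 \<le> card {x. {v, x} \<in> K}"
    and ne: "\<And>a b. {a, b} \<in> K \<Longrightarrow> a \<noteq> b"
    and nxt: "\<And>a b. {a, b} \<in> K \<Longrightarrow> \<exists>c. c \<noteq> a \<and> {b, c} \<in> K"
    using critical_graph[OF assms] by auto
  have no_path: False if "{a, b} \<in> K" "{b, c} \<in> K" "{c, d} \<in> K" "{d, e} \<in> K" "distinct [a, b, c, d, e]"
    for a b c d e
  proof -
    have "embeds {{0,1},{1,2},{2,3},{3,4}} K"
      by (rule embeds_list[of "[a, b, c, d, e]"]) (use that in \<open>auto simp: eval_nat_numeral\<close>)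
    then show False using free by simp
  qed
  have fresh: "\<exists>y. {v, y} \<in> K \<and> y \<notin> set xs" if "length xs < 4" for xs
    using obtain_avoiding[of xs "{x. {v, x} \<in> K}"] v that card_length[of xs] by fastforce
  have inside: "{v, z} \<in> K" if "{v, x} \<in> K" "{x, z} \<in> K" "z \<noteq> v" for x z
  proof (rule ccontr)
    assume z: "{v, z} \<notin> K"
    obtain w where w: "w \<noteq> x" "{z, w} \<in> K" using nxt \<open>{x, z} \<in> K\<close> by blast
    obtain y where y: "{v, y} \<in> K" "y \<notin> set [x, w]" using fresh[of "[x, w]"] by auto
    \<comment> \<open>\<open>w\<close> differs from \<open>v\<close> because \<open>v z\<close> is
      not an edge.\<close>
    show False using no_path[of y v x z w] that z w y ne by (auto simp: insert_commute)
  qed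
  obtain x1 where x1: "{v, x1} \<in> K" using fresh[of "[]"] by auto
  obtain x2 where x2: "x2 \<noteq> v" "{x1, x2} \<in> K" using nxt x1 by blast
  have vx2: "{v, x2} \<in> K" using inside x1 x2 by blast
  obtain x3 where x3: "{v, x3} \<in> K" "x3 \<notin> set [x1, x2]" using fresh[of "[x1, x2]"] by auto
  obtain x4 where x4: "x4 \<noteq> v" "{x3, x4} \<in> K" using nxt x3 by blast
  obtain x5 where x5: "{v, x5} \<in> K" "x5 \<notin> set [x1, x2, x3]"
    using fresh[of "[x1, x2, x3]"] by auto
  note facts = x1 x2 vx2 x3 x4 x5 ne
  consider "x4 = x1" | "x4 = x2" | "x4 \<noteq> x1" "x4 \<noteq> x2" by blast
  then show False
  proof cases
    case 1 then show False
      using no_path[of x2 x1 x3 v x5] facts by (auto simp: insert_commute)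
  next
    case 2 then show False
      using no_path[of x1 x2 x3 v x5] facts by (auto simp: insert_commute)
  next
    case 3 then show False
      using no_path[of x1 x2 v x3 x4] facts by (auto simp: insert_commute)
  qed
qed

subsection \<open>Triple systems\<close>

text \<open>With \<open>k = d = 3\<close> the three reciprocals sum to less than 1. One codegree
  exceeds 3, and the other two are not both at most 2, as two halves already sum to 1.\<close>

lemma critical_triple_system:
  assumes K: "critical 3 3 K"
  obtains a b c where "{a, b, c} \<in> K" "4 \<le> card {x. {a, b, x} \<in> K}" "3 \<le> card {x. {a, c, x} \<in> K}"
    "\<And>a b c. {a, b, c} \<in> K \<Longrightarrow> distinct [a, b, c]"
    "\<And>a b c. {a, b, c} \<in> K \<Longrightarrow> \<exists>d. d \<noteq> a \<and> {b, c, d} \<in> K"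
proof -
  have u: "uniform 3 K" using K by (simp add: critical_def)
  have dist: "distinct [a, b, c]" if "{a, b, c} \<in> K" for a b c
  proof -
    have "card (set [a, b, c]) = length [a, b, c]" using u that by (simp add: uniform_def)
    then show ?thesis by (rule card_distinct)
  qed
  have nxt: "\<exists>d. d \<noteq> a \<and> {b, c, d} \<in> K" if "{a, b, c} \<in> K" for a b c
  proof -
    have "a \<notin> {b, c}" using dist[OF that] by simp
    then obtain d where "d \<noteq> a" "insert d {b, c} \<in> K"
      using critical_second_nbr[OF K, of a "{b, c}"] \<open>{a, b, c} \<in> K\<close> by auto
    then show ?thesis by (auto simp: insert_commute)
  qed
  have nbrs: "nbrs K {a, b} = {x. {a, b, x} \<in> K}" for a b
  proof -
    have "insert x {a, b} = {a, b, x}" for x by auto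
    then show ?thesis using dist[of a b] by (fastforce simp: nbrs_def)
  qed
  obtain e where e: "e \<in> K" "real 3 * (\<Sum>x\<in>e. 1 / real (card (nbrs K (e - {x})))) < real 3"
    using critical_light_edge[OF K] by blast
  obtain c where c: "c \<in> e" "3 < card (nbrs K (e - {c}))"
    using light_edge_heavy_side[OF u e] by blast
  have "card (e - {c}) = 2" using u e c by (simp add: uniform_def)
  then obtain a b where ab: "e - {c} = {a, b}" by (auto simp: card_2_iff)
  have e_eq: "e = {a, b, c}" using ab c by auto
  have d: "distinct [a, b, c]" using dist e(1) e_eq by blast
  have sides: "e - {a} = {b, c}" "e - {b} = {a, c}" using e_eq d by auto
  have fin: "finite {x. {a, b, x} \<in> K}" for a b using finite_nbrs[OF u, of "{a, b}"] nbrs by simp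
  \<comment> \<open>Codegree 0 must be excluded before using \<open>half\<close>, since
    \<open>1 / 0 = 0\<close> in HOL.\<close>
  have pos: "1 \<le> card {x. {b, c, x} \<in> K}" "1 \<le> card {x. {a, c, x} \<in> K}"
  proof -
    have "{b, c, a} = e" "{a, c, b} = e" using e_eq by auto
    then have "a \<in> {x. {b, c, x} \<in> K}" "b \<in> {x. {a, c, x} \<in> K}" using e(1) by auto
    then show "1 \<le> card {x. {b, c, x} \<in> K}" "1 \<le> card {x. {a, c, x} \<in> K}"
      using fin card_gt_0_iff by (metis One_nat_def Suc_leI empty_iff)+
  qed
  have "(\<Sum>x\<in>e. 1 / real (card (nbrs K (e - {x})))) =
        (\<Sum>x\<in>{a, b, c}. 1 / real (card (nbrs K (e - {x}))))"
    using e_eq by simp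
  also have "\<dots> = 1 / real (card {x. {b, c, x} \<in> K}) + 1 / real (card {x. {a, c, x} \<in> K})
      + 1 / real (card {x. {a, b, x} \<in> K})"
    using d by (simp add: sides ab nbrs)
  finally have lt: "1 / real (card {x. {b, c, x} \<in> K}) + 1 / real (card {x. {a, c, x} \<in> K})
      + 1 / real (card {x. {a, b, x} \<in> K}) < 1"
    using e(2) by simp
  have half: "1 / 2 \<le> 1 / real n" if "1 \<le> n" "n < 3" for n :: nat
    using that by (simp add: field_simps)
  have "3 \<le> card {x. {b, c, x} \<in> K} \<or> 3 \<le> card {x. {a, c, x} \<in> K}"
  proof (rule ccontr)
    assume "\<not> ?thesis"
    then have "1 / 2 \<le> 1 / real (card {x. {b, c, x} \<in> K})"
      "1 / 2 \<le> 1 / real (card {x. {a, c, x} \<in> K})"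
      using half pos by (meson not_le)+
    moreover have "0 \<le> 1 / real (card {x. {a, b, x} \<in> K})" by simp
    ultimately show False using lt by linarith
  qed
  moreover have "4 \<le> card {x. {a, b, x} \<in> K}" using c(2) ab nbrs by simp
  \<comment> \<open>If the side of codegree at least 3 is \<open>b c\<close>, the roles of
    \<open>a\<close> and \<open>b\<close> are exchanged.\<close>
  moreover have "{x. {b, a, x} \<in> K} = {x. {a, b, x} \<in> K}" "{b, a, c} = e"
    using e_eq by (auto simp: insert_commute)
  ultimately show thesis
    using that[of a b c] that[of b a c] e(1) e_eq dist nxt by auto
qed

text \<open>The pattern is a triple with one further triple on each side. The extra vertices are
  chosen in order of increasing guaranteed codegree, 2 for \<open>b c\<close>, 3 for
  \<open>a c\<close>, 4 for \<open>a b\<close>, so that each can avoid the earlier ones.\<close>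

lemma critical_triangle:
  assumes "critical 3 3 K"
  shows "embeds {{0,1,2},{0,1,3},{1,2,4},{0,2,5}} K"
proof -
  obtain a b c where abc: "{a, b, c} \<in> K"
    and ab: "4 \<le> card {x. {a, b, x} \<in> K}" and ac: "3 \<le> card {x. {a, c, x} \<in> K}"
    and dist: "\<And>a b c. {a, b, c} \<in> K \<Longrightarrow> distinct [a, b, c]"
    and nxt: "\<And>a b c. {a, b, c} \<in> K \<Longrightarrow> \<exists>d. d \<noteq> a \<and> {b, c, d} \<in> K"
    using critical_triple_system[OF assms] by blast
  obtain x where x: "x \<noteq> a" "{b, c, x} \<in> K" using nxt abc by blast
  have "card (set [b, x]) < card {x. {a, c, x} \<in> K}"
    using ac card_length[of "[b, x]"] by simp
  then obtain y where y: "{a, c, y} \<in> K" "y \<notin> set [b, x]" using obtain_avoiding by blast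
  have "card (set [c, x, y]) < card {x. {a, b, x} \<in> K}"
    using ab card_length[of "[c, x, y]"] by simp
  then obtain z where z: "{a, b, z} \<in> K" "z \<notin> set [c, x, y]" using obtain_avoiding by blast
  show ?thesis
    by (rule embeds_list[of "[a, b, c, z, x, y]"])
       (use abc x y z dist[OF abc] dist[OF x(2)] dist[OF y(1)] dist[OF z(1)] in auto)
qed

text \<open>Without a tight path, some \<open>y\<close> forms all four triples with
  \<open>a\<close>, \<open>b\<close>, \<open>c\<close>, and the pairs \<open>a y\<close>,
  \<open>b y\<close>, \<open>c y\<close> lie in no other edges. Deleting the three of these triples
  that contain \<open>y\<close> is then forbidden by \<open>critical_removal\<close>.\<close>

lemma critical_tight_path:
  assumes K: "critical 3 3 K"
  shows "embeds {{0,1,2},{1,2,3},{2,3,4},{3,4,5}} K"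
proof (rule ccontr)
  assume free: "\<not> ?thesis"
  obtain a b c where abc: "{a, b, c} \<in> K"
    and ab: "4 \<le> card {x. {a, b, x} \<in> K}" and ac: "3 \<le> card {x. {a, c, x} \<in> K}"
    and dist: "\<And>a b c. {a, b, c} \<in> K \<Longrightarrow> distinct [a, b, c]"
    and nxt: "\<And>a b c. {a, b, c} \<in> K \<Longrightarrow> \<exists>d. d \<noteq> a \<and> {b, c, d} \<in> K"
    using critical_triple_system[OF K] by blast
  have no_path: False
    if "{u, v, w} \<in> K" "{v, w, x} \<in> K" "{w, x, y} \<in> K" "{x, y, z} \<in> K"
      "distinct [u, v, w, x, y, z]" for u v w x y z
  proof -
    have "embeds {{0,1,2},{1,2,3},{2,3,4},{3,4,5}} K"
      by (rule embeds_list[of "[u, v, w, x, y, z]"]) (use that in \<open>auto simp: eval_nat_numeral\<close>)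
    then show False using free by simp
  qed
  \<comment> \<open>otherwise \<open>p y x a b q\<close> is a tight path\<close>
  have closed: "p = b"
    if "4 \<le> card {x. {a, b, x} \<in> K}" "{a, b, x} \<in> K" "{a, x, y} \<in> K" "y \<noteq> b" "{x, y, p} \<in> K" "p \<noteq> a"
    for a b x y p
  proof (rule ccontr)
    assume "p \<noteq> b"
    have "card (set [x, y, p]) < card {x. {a, b, x} \<in> K}"
      using that(1) card_length[of "[x, y, p]"] by simp
    then obtain q where q: "{a, b, q} \<in> K" "q \<notin> set [x, y, p]" using obtain_avoiding by blast
    have "{p, y, x} \<in> K" "{y, x, a} \<in> K" "{x, a, b} \<in> K"
      using that by (auto simp: insert_commute)
    then show False using no_path[of p y x a b q] q \<open>p \<noteq> b\<close> that(4,6)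
      dist[OF that(2)] dist[OF that(3)] dist[OF that(5)] dist[OF q(1)] by auto
  qed
  \<comment> \<open>The pair \<open>x y\<close> lies in a second edge, and \<open>closed\<close>
    forces its third vertex to be \<open>b\<close>.\<close>
  have transfer: "{b, x, y} \<in> K"
    if "4 \<le> card {x. {a, b, x} \<in> K}" "{a, b, x} \<in> K" "{a, x, y} \<in> K" "y \<noteq> b" for a b x y
  proof -
    obtain p where p: "p \<noteq> a" "{x, y, p} \<in> K" using nxt \<open>{a, x, y} \<in> K\<close> by blast
    then have "p = b" using closed that by blast
    then show ?thesis using p by (simp add: insert_commute)
  qed
  have ba: "4 \<le> card {x. {b, a, x} \<in> K}" using ab by (simp add: insert_commute)
  define C where "C = {y. {a, c, y} \<in> K} - {b}"
  have u: "uniform 3 K" using K by (simp add: critical_def)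
  have fin: "finite {x. {a, b, x} \<in> K}" for a b
  proof -
    have "{x. {a, b, x} \<in> K} \<subseteq> \<Union>K" by auto
    then show ?thesis using u finite_subset unfolding uniform_def by blast
  qed
  have cardC: "2 \<le> card C"
    unfolding C_def using ac by (auto simp: card_Diff_singleton_if)
  \<comment> \<open>If \<open>C\<close> has at least 3 elements, any \<open>y\<close> other than
    \<open>c\<close> works; if it has 2, one of the four or more neighbours of \<open>a b\<close>
    lies outside \<open>insert c C\<close>.\<close>
  have "\<exists>y. {a, b, y} \<in> K \<and> y \<noteq> c \<and> 2 \<le> card (C - {y})"
  proof (cases "3 \<le> card C")
    case True
    have "card (set [c]) < card {x. {a, b, x} \<in> K}" using ab by simp
    then obtain y where "{a, b, y} \<in> K" "y \<notin> set [c]" using obtain_avoiding by blast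
    then show ?thesis using True by (intro exI[of _ y]) (auto simp: card_Diff_singleton_if)
  next
    case False
    have "finite C" unfolding C_def using fin by simp
    then have "card (insert c C) < card {x. {a, b, x} \<in> K}"
      using False ab by (simp add: card_insert_if)
    then have "\<not> {x. {a, b, x} \<in> K} \<subseteq> insert c C"
      using card_mono[of "insert c C"] \<open>finite C\<close> by (metis finite_insert not_less)
    then obtain y where "{a, b, y} \<in> K" "y \<notin> insert c C" by blast
    then show ?thesis using cardC by (intro exI[of _ y]) simp
  qed
  then obtain y where y: "{a, b, y} \<in> K" "y \<noteq> c" "2 \<le> card (C - {y})" by blast
  \<comment> \<open>otherwise \<open>z c a b y w\<close> is a tight path for some \<open>z \<in> C\<close>\<close>
  have only_c: "w = c" if "{b, y, w} \<in> K" "w \<noteq> a" for w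
  proof (rule ccontr)
    assume "w \<noteq> c"
    have "card (set [w]) < card (C - {y})" using y(3) by simp
    then obtain z where z: "z \<in> C - {y}" "z \<notin> set [w]" using obtain_avoiding by blast
    then have zK: "{a, c, z} \<in> K" "z \<noteq> b" by (auto simp: C_def)
    have "{z, c, a} \<in> K" "{c, a, b} \<in> K" using zK abc by (auto simp: insert_commute)
    then show False using no_path[of z c a b y w] y z zK that \<open>w \<noteq> c\<close>
      dist[OF abc] dist[OF zK(1)] dist[OF y(1)] dist[OF that(1)] by auto
  qed
  obtain w where "w \<noteq> a" "{b, y, w} \<in> K" using nxt y(1) by blast
  then have byc: "{b, y, c} \<in> K" using only_c by blast
  have bay: "{b, a, y} \<in> K" using y(1) by (simp add: insert_commute)
  have ayc: "{a, y, c} \<in> K"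
    using transfer[OF ba bay byc] dist[OF abc] by auto
  have d: "distinct [a, b, c, y]" using dist[OF abc] dist[OF y(1)] y(2) by auto
  have at_by: "w = a \<or> w = c" if "{b, y, w} \<in> K" for w using only_c that by blast
  \<comment> \<open>\<open>transfer\<close> turns an edge on \<open>a y\<close> avoiding
    \<open>b\<close> into one on \<open>b y\<close>, where \<open>only_c\<close> applies.\<close>
  have at_ay: "w = b \<or> w = c" if "{a, y, w} \<in> K" for w
    using transfer[OF ab y(1) that] only_c dist[OF that] by auto
  have acy: "{a, c, y} \<in> K" using ayc by (simp add: insert_commute)
  have at_cy: "w = a \<or> w = b" if "{c, y, w} \<in> K" for w
    using closed[OF ab abc acy _ that] d by auto
  \<comment> \<open>the pairs \<open>a y\<close>, \<open>b y\<close>, \<open>c y\<close> now lie in no edges besides these three\<close>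
  let ?F = "{{a, b, y}, {a, y, c}, {b, y, c}}" and ?M = "{{a, y}, {b, y}, {c, y}}"
  have cards: "card ?F = 3" "card ?M = 3" using d by (auto simp: card_insert_if doubleton_eq_iff)
  \<comment> \<open>Three edges go and three pairs go with them, so this strict inequality is
    absurd.\<close>
  have "3 * card ?M < 3 * card ?F"
  proof (rule critical_removal[OF K])
    show "?F \<subseteq> K" using y(1) ayc byc by simp
    have "{a, y} = {a, b, y} - {b}" "{b, y} = {a, b, y} - {a}" "{c, y} = {a, y, c} - {a}"
      using d by auto
    then show "?M \<subseteq> shadow K" using y(1) ayc unfolding shadow_def by blast
    have gone: "{v, y} \<notin> shadow (K - ?F)" if "\<And>w. {v, y, w} \<in> K \<Longrightarrow> {v, y, w} \<in> ?F" for v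
    proof
      assume "{v, y} \<in> shadow (K - ?F)"
      then obtain e w where e: "e \<in> K - ?F" "w \<in> e" "{v, y} = e - {w}"
        by (auto simp: shadow_def)
      then have "e = {v, y, w}" by auto
      then show False using e that by blast
    qed
    have "{a, y} \<notin> shadow (K - ?F)" by (rule gone) (use at_ay in \<open>auto simp: insert_commute\<close>)
    moreover have "{b, y} \<notin> shadow (K - ?F)" by (rule gone) (use at_by in \<open>auto simp: insert_commute\<close>)
    moreover have "{c, y} \<notin> shadow (K - ?F)" by (rule gone) (use at_cy in \<open>auto simp: insert_commute\<close>)
    ultimately show "?M \<inter> shadow (K - ?F) = {}" by blast
  qed simp
  then show False using cards by simp
qed

text \<open>A violating \<open>H\<close> contains a critical family for \<open>d = t - 1\<close>, in
  which each pattern was found above.\<close>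

lemma tree_core_bound:
  assumes "tree_core k t P" "uniform k H" "\<not> embeds P H"
  shows "k * card H \<le> (t - 1) * card (shadow H)"
proof (rule ccontr)
  assume "\<not> ?thesis"
  then obtain K where K: "K \<subseteq> H" "critical k (t - 1) K"
    using critical_subfamily[OF assms(2)] by (metis not_le)
  from assms(1) have "embeds P K"
  proof cases
    case star
    then show ?thesis using critical_star[of "t - 1" K] K by simp
  next
    case path3
    then show ?thesis using critical_path3 K by simp
  next
    case fork
    then show ?thesis using critical_fork K by simp
  next
    case path4
    then show ?thesis using critical_path4 K by simp
  next
    case triangle
    then show ?thesis using critical_triangle K by simp
  next
    case tight_path
    then show ?thesis using critical_tight_path K by simp
  qed
  then show False using assms(3) K embeds_mono by blast
qed

subsection \<open>Links\<close>

lemma link_subset: "link H S \<subseteq> (\<lambda>e. e - S) ` H"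
proof
  fix A assume "A \<in> link H S"
  then have "A = (S \<union> A) - S" "S \<union> A \<in> H" by (auto simp: link_def)
  then show "A \<in> (\<lambda>e. e - S) ` H" by blast
qed

lemma uniform_link:
  assumes "uniform r H" "finite S" "card S + k = r"
  shows "uniform k (link H S)"
proof -
  have "finite (link H S)"
    using link_subset[of H S] assms(1) finite_subset unfolding uniform_def by blast
  moreover have "finite A \<and> card A = k" if "A \<in> link H S" for A
  proof -
    have A: "A \<inter> S = {}" "S \<union> A \<in> H" using that by (auto simp: link_def)
    then have fin: "finite A" and "card (S \<union> A) = r" using assms(1) by (auto simp: uniform_def)
    moreover have "card (S \<union> A) = card S + card A"
      using A fin assms(2) by (intro card_Un_disjoint) auto
    ultimately show ?thesis using assms(3) by simp
  qed
  ultimately show ?thesis by (simp add: uniform_def)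
qed

text \<open>The averaging bounds links from below by edges and their shadows from above by shadow
  members, hence the one-sided inequalities here and in \<open>card_shadow_link_le\<close>.\<close>

lemma card_link_ge:
  assumes "uniform r H"
  shows "card {e \<in> H. S \<subseteq> e} \<le> card (link H S)"
proof (rule card_inj_on_le)
  show "inj_on (\<lambda>e. e - S) {e \<in> H. S \<subseteq> e}" by (auto simp: inj_on_def)
  show "(\<lambda>e. e - S) ` {e \<in> H. S \<subseteq> e} \<subseteq> link H S" by (auto simp: link_def Un_absorb1)
  show "finite (link H S)"
    using link_subset[of H S] assms finite_subset unfolding uniform_def by blast
qed

lemma card_shadow_link_le:
  assumes "uniform r H"
  shows "card (shadow (link H S)) \<le> card {f \<in> shadow H. S \<subseteq> f}"
proof (rule card_inj_on_le)
  show "inj_on (\<lambda>A. S \<union> A) (shadow (link H S))"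
    by (rule inj_on_inverseI[of _ "\<lambda>B. B - S"]) (auto simp: shadow_def link_def)
  show "(\<lambda>A. S \<union> A) ` shadow (link H S) \<subseteq> {f \<in> shadow H. S \<subseteq> f}"
  proof (rule image_subsetI)
    fix B assume "B \<in> shadow (link H S)"
    then obtain A x where "A \<inter> S = {}" "S \<union> A \<in> H" "x \<in> A" "B = A - {x}"
      by (auto simp: shadow_def link_def)
    moreover from this have "S \<union> B = (S \<union> A) - {x}" "x \<in> S \<union> A" by auto
    ultimately show "S \<union> B \<in> {f \<in> shadow H. S \<subseteq> f}" unfolding shadow_def by blast
  qed
  show "finite {f \<in> shadow H. S \<subseteq> f}" using finite_shadow[OF assms] by simp
qed

text \<open>Summing the bounds over all links and dividing by \<open>k * (r choose k) = r * ((r - 1) choose (k - 1))\<close>.\<close>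

lemma shadow_bound_from_links:
  assumes H: "uniform r H" and k: "1 \<le> k" "k \<le> r"
    and links: "\<And>S. finite S \<Longrightarrow> card S + k = r \<Longrightarrow>
      k * card (link H S) \<le> d * card (shadow (link H S))"
  shows "r * card H \<le> d * card (shadow H)"
proof -
  let ?V = "\<Union>H"
  let ?S = "{S. S \<subseteq> ?V \<and> card S = r - k}"
  have finV: "finite ?V" using H by (auto simp: uniform_def)
  then have finS: "finite ?S" by simp
  \<comment> \<open>Double counting of pairs \<open>S\<close>, \<open>f\<close> with
    \<open>S\<close> inside \<open>f\<close>, applied to the edges with \<open>m = r\<close> and to
    the shadow with \<open>m = r - 1\<close>.\<close>
  have count: "(\<Sum>S\<in>?S. card {f \<in> F. S \<subseteq> f}) = (m choose (r - k)) * card F"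
    if F: "finite F" "\<And>f. f \<in> F \<Longrightarrow> f \<subseteq> ?V \<and> card f = m" for F m
  proof (rule sum_multicount[OF finS F(1)], rule ballI)
    fix f assume f: "f \<in> F"
    then have "{S \<in> ?S. S \<subseteq> f} = {S. S \<subseteq> f \<and> card S = r - k}" using F(2) by blast
    moreover have "finite f" using F(2)[OF f] finV finite_subset by blast
    ultimately show "card {S \<in> ?S. S \<subseteq> f} = m choose (r - k)" using n_subsets[of f "r - k"] F(2)[OF f] by simp
  qed
  have "k * ((r choose (r - k)) * card H) = k * (\<Sum>S\<in>?S. card {e \<in> H. S \<subseteq> e})"
    using H by (subst count) (auto simp: uniform_def)
  also have "\<dots> \<le> (\<Sum>S\<in>?S. k * card (link H S))"
    unfolding sum_distrib_left by (intro sum_mono mult_le_mono2 card_link_ge[OF H])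
  also have "\<dots> \<le> (\<Sum>S\<in>?S. d * card {f \<in> shadow H. S \<subseteq> f})"
  proof (rule sum_mono)
    fix S assume S: "S \<in> ?S"
    then have "finite S" using finV finite_subset by blast
    then have "k * card (link H S) \<le> d * card (shadow (link H S))" using S k by (intro links) auto
    also have "\<dots> \<le> d * card {f \<in> shadow H. S \<subseteq> f}"
      by (intro mult_le_mono2 card_shadow_link_le[OF H])
    finally show "k * card (link H S) \<le> d * card {f \<in> shadow H. S \<subseteq> f}" .
  qed
  also have "\<dots> = d * (((r - 1) choose (r - k)) * card (shadow H))"
    unfolding sum_distrib_left[symmetric] using H finite_shadow[OF H]
    by (subst count[where m = "r - 1"]) (auto simp: uniform_def shadow_def)
  finally have le: "k * ((r choose (r - k)) * card H) \<le> d * (((r - 1) choose (r - k)) * card (shadow H))" .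
  obtain j m where jm: "k = Suc j" "r = Suc m" using k by (metis Suc_le_D le_trans One_nat_def)
  have "r choose (r - k) = r choose k" "(r - 1) choose (r - k) = (r - 1) choose j"
    using k binomial_symmetric[of k r] binomial_symmetric[of j m] jm by auto
  then have "k * (r choose (r - k)) = r * ((r - 1) choose (r - k))"
    using Suc_times_binomial_eq[of m j] jm by (simp add: mult.commute)
  then have "((r - 1) choose (r - k)) * (r * card H) \<le> ((r - 1) choose (r - k)) * (d * card (shadow H))"
    using le by (metis mult.assoc mult.left_commute)
  \<comment> \<open>Since \<open>1 \<le> k\<close>, the lower index is at most \<open>r - 1\<close>
    and the factor can be cancelled.\<close>
  moreover have "0 < (r - 1) choose (r - k)" using k by (intro zero_less_binomial) auto
  ultimately show ?thesis by simp
qed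

section \<open>Cones over patterns and their copies in a host\<close>

lemma tree_core_uniform:
  assumes "tree_core k t P"
  shows "P \<noteq> {}" "A \<in> P \<Longrightarrow> card A = k" "1 \<le> k"
  using assms by (cases; force simp: lessThan_empty_iff)+

text \<open>Any one edge is the disjoint union of \<open>S\<close> and a \<open>k\<close>-set, which
  settles the size and finiteness of \<open>S\<close>.\<close>

lemma cone_uniformity:
  assumes T: "r_graph r T" and P: "P \<noteq> {}" "\<And>A. A \<in> P \<Longrightarrow> card A = k"
    and cone: "is_cone P (edges T)"
  obtains S g where "inj_on g (\<Union>P)" "S \<inter> g ` \<Union>P = {}" "edges T = (\<lambda>A. S \<union> g ` A) ` P"
    "finite S" "card S + k = r"
proof -
  obtain S g where g: "inj_on g (\<Union>P)" and dis: "S \<inter> g ` \<Union>P = {}"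
    and E: "edges T = (\<lambda>A. S \<union> g ` A) ` P"
    using cone by (auto simp: is_cone_def)
  obtain A where A: "A \<in> P" using P by blast
  have "S \<union> g ` A \<in> edges T" using E A by blast
  then have edge: "finite (S \<union> g ` A)" "card (S \<union> g ` A) = r"
    using T finite_subset unfolding r_graph_def by blast+
  have "card (S \<union> g ` A) = card S + card (g ` A)"
    using edge dis A by (intro card_Un_disjoint) auto
  moreover have "card (g ` A) = k"
    using P(2)[OF A] g A by (metis card_image inj_on_subset Sup_upper)
  ultimately show thesis using that[OF g dis E] edge by simp
qed

text \<open>Send \<open>S\<close> to \<open>S'\<close> by any bijection and \<open>g i\<close> to
  \<open>h i\<close>. The two images are disjoint because members of the link avoid
  \<open>S'\<close>.\<close>

lemma cone_contained:
  assumes T: "r_graph r T" "verts T = \<Union>(edges T)"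
    and P: "P \<noteq> {}" "\<And>A. A \<in> P \<Longrightarrow> card A = k"
    and cone: "is_cone P (edges T)" and G: "r_graph r G"
    and S': "finite S'" "card S' + k = r" and emb: "embeds P (link (edges G) S')"
  shows "contains G T"
proof -
  obtain S g where g: "inj_on g (\<Union>P)" and dis: "S \<inter> g ` \<Union>P = {}"
    and E: "edges T = (\<lambda>A. S \<union> g ` A) ` P" and S: "finite S" "card S + k = r"
    using cone_uniformity[OF T(1) P cone] .
  obtain h where h: "inj_on h (\<Union>P)" "\<And>A. A \<in> P \<Longrightarrow> h ` A \<in> link (edges G) S'"
    using emb by (auto simp: embeds_def)
  have "card S = card S'" using S S'(2) by simp
  then obtain b where b: "bij_betw b S S'"
    using S(1) S'(1) finite_same_card_bij by blast
  define f where "f x = (if x \<in> S then b x else h (inv_into (\<Union>P) g x))" for x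
  have fg: "f (g i) = h i" if "i \<in> \<Union>P" for i
  proof -
    have "g i \<notin> S" using dis that by blast
    then show ?thesis using g that by (simp add: f_def)
  qed
  have fS: "f ` S = S'" using b by (auto simp: f_def bij_betw_def)
  have f_edge: "f ` (S \<union> g ` B) = S' \<union> h ` B" if "B \<in> P" for B
  proof -
    have "f ` g ` B = h ` B" unfolding image_image using that fg by (intro image_cong) auto
    then show ?thesis by (simp add: image_Un fS)
  qed
  have edges: "f ` e \<in> edges G" if e: "e \<in> edges T" for e
    using e h(2) f_edge by (auto simp: E link_def)
  have verts: "verts T = S \<union> g ` \<Union>P" using T(2) P(1) by (auto simp: E)
  have "inj_on f (S \<union> g ` \<Union>P)"
  proof -
    have "inj_on f S" using b by (auto simp: f_def bij_betw_def inj_on_def)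
    moreover have "inj_on f (g ` \<Union>P)"
      using h(1) by (intro inj_on_imageI) (auto simp: fg inj_on_def)
    moreover have "f ` S \<inter> f ` g ` \<Union>P = {}"
    proof -
      have "f ` g ` \<Union>P = h ` \<Union>P" unfolding image_image using fg by (intro image_cong) auto
      moreover have "S' \<inter> h ` A = {}" if "A \<in> P" for A
        using h(2)[OF that] by (auto simp: link_def)
      ultimately show ?thesis unfolding fS by auto
    qed
    ultimately show ?thesis by (auto simp: inj_on_Un)
  qed
  moreover have "f ` verts T \<subseteq> verts G"
    using edges G unfolding T(2) r_graph_def by blast
  ultimately show ?thesis unfolding contains_def verts using edges by blast
qed

subsection \<open>Tight trees with at most four edges\<close>

text \<open>A tree step seen as a vertex exchange: an earlier edge \<open>b\<close> trades
  \<open>u\<close> for a new vertex \<open>v\<close>.\<close>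

definition attach :: "'a set set \<Rightarrow> 'a set \<Rightarrow> bool" where
  "attach E e \<longleftrightarrow> (\<exists>b\<in>E. \<exists>u\<in>b. \<exists>v. v \<notin> \<Union>E \<and> e = insert v (b - {u}))"

lemma tight_tree_order:
  assumes "tight_tree r T"
  obtains es where "es \<noteq> []" "distinct es" "set es = edges T"
    "\<And>i. 1 \<le> i \<Longrightarrow> i < length es \<Longrightarrow> attach (set (take i es)) (es ! i)"
proof -
  obtain es where es: "es \<noteq> []" "distinct es" "set es = edges T"
    and step: "\<forall>i. 1 \<le> i \<and> i < length es \<longrightarrow>
      (\<exists>v\<in>es ! i. \<exists>s<i. v \<notin> (\<Union>j<i. es ! j) \<and> es ! i - {v} \<subseteq> es ! s)"
    using assms[unfolded tight_tree_def] by (elim conjE exE) (rule that)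
  have edge: "finite (es ! i)" "card (es ! i) = r" if "i < length es" for i
  proof -
    have "es ! i \<in> edges T" "r_graph r T"
      using es(3) that assms by (auto simp: tight_tree_def)
    then show "finite (es ! i)" "card (es ! i) = r"
      unfolding r_graph_def using finite_subset by blast+
  qed
  have "attach (set (take i es)) (es ! i)" if i: "1 \<le> i" "i < length es" for i
  proof -
    obtain v s where v: "v \<in> es ! i" "s < i" "v \<notin> (\<Union>j<i. es ! j)" "es ! i - {v} \<subseteq> es ! s"
      using step i by blast
    \<comment> \<open>By uniformity \<open>es ! i - {v}\<close> misses exactly one vertex
      \<open>u\<close> of \<open>es ! s\<close>.\<close>
    have "card (es ! s - (es ! i - {v})) = card (es ! s) - card (es ! i - {v})"
      using v edge[OF i(2)] by (intro card_Diff_subset) auto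
    moreover have "card (es ! i - {v}) = r - 1" "r \<noteq> 0"
      using v(1) edge[OF i(2)] by (simp, metis card_0_eq empty_iff)
    ultimately have "card (es ! s - (es ! i - {v})) = 1"
      using edge(2)[of s] v(2) i(2) by simp
    then obtain u where u: "es ! s - (es ! i - {v}) = {u}" by (auto simp: card_1_singleton_iff)
    have "es ! i = insert v (es ! s - {u})" using u v(1,4) by blast
    moreover have take: "set (take i es) = (!) es ` {..<i}"
      using i(2) nth_image[of i es] by (simp add: atLeast0LessThan)
    moreover have "es ! s \<in> set (take i es)" "u \<in> es ! s" using take v(2) u by auto
    ultimately show ?thesis unfolding attach_def using v(3) by metis
  qed
  then show thesis by (rule that[OF es])
qed

section \<open>Stars, paths and the effect of attaching an edge\<close>

lemma is_cone_list:
  assumes "distinct xs" "set xs \<inter> S = {}" "\<forall>A\<in>P. \<forall>i\<in>A. i < length xs"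
    and "E = (\<lambda>A. S \<union> (!) xs ` A) ` P"
  shows "is_cone P E"
  unfolding is_cone_def
proof (intro exI conjI)
  show "inj_on ((!) xs) (\<Union>P)" using assms by (intro inj_on_nth) auto
  have "(!) xs ` \<Union>P \<subseteq> set xs" using assms(3) by auto
  then show "S \<inter> (!) xs ` \<Union>P = {}" using assms(2) by blast
qed (rule assms(4))

text \<open>A cone over the \<open>star\<close> pattern, given by its set \<open>X\<close> of
  varying vertices instead of a labelling, so that growing it means enlarging
  \<open>X\<close>.\<close>

definition is_star :: "nat \<Rightarrow> 'a set set \<Rightarrow> bool" where
  "is_star n E \<longleftrightarrow>
     (\<exists>S X. finite X \<and> card X = n \<and> X \<inter> S = {} \<and> E = (\<lambda>x. insert x S) ` X)"

lemma is_star_cone: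
  assumes "is_star n E"
  shows "is_cone ((\<lambda>i. {i}) ` {..<n}) E"
proof -
  obtain S X where X: "finite X" "card X = n" "X \<inter> S = {}" "E = (\<lambda>x. insert x S) ` X"
    using assms by (auto simp: is_star_def)
  obtain xs where xs: "set xs = X" "distinct xs" using finite_distinct_list X(1) by blast
  then have len: "length xs = n" using X(2) distinct_card by metis
  then have "X = (!) xs ` {..<n}" using xs by (auto simp: set_conv_nth)
  then show ?thesis using xs X len by (intro is_cone_list[of xs S]) (auto simp: image_image)
qed

text \<open>If the exchanged vertex lies outside the kernel, the star grows. If it is a kernel
  vertex \<open>u\<close>, then over the kernel without \<open>u\<close>, called \<open>S\<close> in
  the case \<open>other\<close>, the edges form a graph star centred at \<open>u\<close>, and
  \<open>e\<close> extends its leaf \<open>x\<close> to \<open>v\<close>.\<close>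

lemma attach_star:
  assumes "is_star n E" "attach E e"
  obtains (star) "is_star (Suc n) (insert e E)"
  | (other) S X x u v where "finite X" "card X = n" "x \<in> X" "X \<inter> S = {}" "u \<notin> S" "u \<notin> X"
      "v \<notin> S" "v \<notin> X" "v \<noteq> u" "E = (\<lambda>y. S \<union> {u, y}) ` X" "e = S \<union> {x, v}"
proof -
  obtain S X where X: "finite X" "card X = n" "X \<inter> S = {}" "E = (\<lambda>x. insert x S) ` X"
    using assms(1) by (auto simp: is_star_def)
  obtain b u v where b: "b \<in> E" "u \<in> b" "v \<notin> \<Union>E" "e = insert v (b - {u})"
    using assms(2) by (auto simp: attach_def)
  obtain x where x: "x \<in> X" "b = insert x S" using b(1) X(4) by blast
  have v: "v \<notin> S" "v \<notin> X" using b(3) x(1) X(4) by auto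
  show thesis
  proof (cases "u \<in> S")
    case False
    then have "e = insert v S" using b x by auto
    then have "insert e E = (\<lambda>x. insert x S) ` insert v X" using X(4) by simp
    moreover have "card (insert v X) = Suc n" "insert v X \<inter> S = {}" using X v by auto
    ultimately have "is_star (Suc n) (insert e E)"
      unfolding is_star_def using X(1) by blast
    then show thesis by (rule star)
  next
    case True
    have S: "insert y S = (S - {u}) \<union> {u, y}" for y using True by auto
    show thesis
    proof (rule other)
      show "E = (\<lambda>y. (S - {u}) \<union> {u, y}) ` X" using X(4) S by simp
      show "e = (S - {u}) \<union> {x, v}" using b(4) x X(3) True by auto
    qed (use X x v True in auto)
  qed
qed

text \<open>For a single edge the case \<open>other\<close> is again a star, with kernel
  \<open>insert x S\<close>.\<close>

lemma attach_star1:
  assumes "is_star 1 E" "attach E e"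
  shows "is_star 2 (insert e E)"
  using assms
proof (cases rule: attach_star)
  case star
  then show ?thesis by (simp add: eval_nat_numeral)
next
  case (other S X x u v)
  note * = this
  have "X = {x}" using * by (auto simp: card_1_singleton_iff)
  then have "insert e E = (\<lambda>y. insert y (insert x S)) ` {u, v}" using * by (auto simp: insert_commute)
  moreover have "finite {u, v}" "card {u, v} = 2" "{u, v} \<inter> insert x S = {}" using * by auto
  ultimately show ?thesis unfolding is_star_def by blast
qed

definition is_path3 :: "'a set set \<Rightarrow> bool" where
  "is_path3 E \<longleftrightarrow> (\<exists>S a b c d. distinct [a, b, c, d] \<and> {a, b, c, d} \<inter> S = {} \<and>
     E = {S \<union> {a, b}, S \<union> {b, c}, S \<union> {c, d}})"

lemma is_path3_cone: "is_path3 E \<Longrightarrow> is_cone {{0,1},{1,2},{2,3}} E"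
proof -
  assume "is_path3 E"
  then obtain S a b c d where *: "distinct [a, b, c, d]" "{a, b, c, d} \<inter> S = {}"
    "E = {S \<union> {a, b}, S \<union> {b, c}, S \<union> {c, d}}"
    by (auto simp: is_path3_def)
  show ?thesis by (rule is_cone_list[of "[a, b, c, d]" S]) (use * in auto)
qed

text \<open>In the case \<open>other\<close>, the two-leaf star at \<open>u\<close> is prolonged to
  the path \<open>y u x v\<close>.\<close>

lemma attach_star2:
  assumes "is_star 2 E" "attach E e"
  shows "is_star 3 (insert e E) \<or> is_path3 (insert e E)"
  using assms
proof (cases rule: attach_star)
  case star
  then show ?thesis by (simp add: eval_nat_numeral)
next
  case (other S X x u v)
  note * = this
  have "card (X - {x}) = 1" using * by simp
  then obtain y where "X - {x} = {y}" by (auto simp: card_1_singleton_iff)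
  then have y: "X = {x, y}" "x \<noteq> y" using *(3) by auto
  have "insert e E = {S \<union> {y, u}, S \<union> {u, x}, S \<union> {x, v}}" using * y by (simp add: insert_commute)
  moreover have "distinct [y, u, x, v]" "{y, u, x, v} \<inter> S = {}" using * y by auto
  ultimately show ?thesis unfolding is_path3_def by blast
qed

lemma attach_star3:
  assumes "is_star 3 E" "attach E e"
  shows "is_star 4 (insert e E) \<or> is_cone {{0,1},{0,2},{0,3},{1,4}} (insert e E)"
  using assms
proof (cases rule: attach_star)
  case star
  then show ?thesis by (simp add: eval_nat_numeral)
next
  case (other S X x u v)
  note * = this
  then have "card (X - {x}) = 2" by simp
  then obtain y z where "X - {x} = {y, z}" "y \<noteq> z" by (auto simp: card_2_iff)
  then have y: "X = {x, y, z}" "distinct [x, y, z]" using * by auto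
  have "insert e E = {S \<union> {u, x}, S \<union> {u, y}, S \<union> {u, z}, S \<union> {x, v}}"
    using * y by (simp add: insert_commute)
  then have "is_cone {{0,1},{0,2},{0,3},{1,4}} (insert e E)"
    by (intro is_cone_list[of "[u, x, y, z, v]" S]) (use * y in auto)
  then show ?thesis by blast
qed

text \<open>If a path vertex is exchanged, the new edge hangs from an inner vertex (fork) or from an
  end (path). If a vertex \<open>u\<close> of \<open>S\<close> is exchanged, the edges become
  triples over \<open>S - {u}\<close>: an exchange in the middle edge gives the triangle pattern, in
  an end edge the tight path.\<close>

lemma attach_path3:
  assumes "is_path3 E" "attach E e"
  obtains k P where "tree_core k 4 P" "is_cone P (insert e E)"
proof -
  obtain S a b c d where dist: "distinct [a, b, c, d]" "{a, b, c, d} \<inter> S = {}"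
    and E: "E = {S \<union> {a, b}, S \<union> {b, c}, S \<union> {c, d}}"
    using assms(1) by (auto simp: is_path3_def)
  obtain f u v where f: "f \<in> E" "u \<in> f" "v \<notin> \<Union>E" "e = insert v (f - {u})"
    using assms(2) by (auto simp: attach_def)
  have v: "v \<notin> S" "distinct [a, b, c, d, v]" "distinct [v, d, c, b, a]"
    using f(3) dist by (auto simp: E)
  have neq: "u \<noteq> v" using f by blast
  have E_elim: "f = S \<union> {a, b} \<or> f = S \<union> {b, c} \<or> f = S \<union> {c, d}"
    using f(1) by (simp add: E)
  show thesis
  proof (cases "u \<in> S")
    case False
    have "e = S \<union> {b, v} \<or> e = S \<union> {a, v} \<or> e = S \<union> {c, v} \<or> e = S \<union> {d, v}"
    proof -
      \<comment> \<open>Exchanging one endpoint of a path edge keeps the other, from which the new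
        edge hangs.\<close>
      have drop: "insert v ((S \<union> {x, y}) - {u}) = S \<union> {if u = x then y else x, v}"
        if "u = x \<or> u = y" "x \<noteq> y" "{x, y} \<inter> S = {}" for x y
        using that False by auto
      from E_elim show ?thesis
      proof (elim disjE)
        assume "f = S \<union> {a, b}"
        then show ?thesis using f(2,4) drop[of a b] dist False by auto
      next
        assume "f = S \<union> {b, c}"
        then show ?thesis using f(2,4) drop[of b c] dist False by auto
      next
        assume "f = S \<union> {c, d}"
        then show ?thesis using f(2,4) drop[of c d] dist False by auto
      qed
    qed
    then show thesis
    proof (elim disjE)
      assume e: "e = S \<union> {b, v}"
      have "insert e E = {S \<union> {b, c}, S \<union> {b, a}, S \<union> {b, v}, S \<union> {c, d}}"
        unfolding E e by (simp add: insert_commute)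
      then have "is_cone {{0,1},{0,2},{0,3},{1,4}} (insert e E)"
        by (intro is_cone_list[of "[b, c, a, v, d]" S]) (use dist v in simp_all)
      then show thesis by (rule that[OF tree_core.fork])
    next
      assume e: "e = S \<union> {a, v}"
      have "insert e E = {S \<union> {v, a}, S \<union> {a, b}, S \<union> {b, c}, S \<union> {c, d}}"
        unfolding E e by (simp add: insert_commute)
      then have "is_cone {{0,1},{1,2},{2,3},{3,4}} (insert e E)"
        by (intro is_cone_list[of "[v, a, b, c, d]" S]) (use dist v in simp_all)
      then show thesis by (rule that[OF tree_core.path4])
    next
      assume e: "e = S \<union> {c, v}"
      have "insert e E = {S \<union> {c, b}, S \<union> {c, d}, S \<union> {c, v}, S \<union> {b, a}}"
        unfolding E e by (simp add: insert_commute)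
      then have "is_cone {{0,1},{0,2},{0,3},{1,4}} (insert e E)"
        by (intro is_cone_list[of "[c, b, d, v, a]" S]) (use dist v in simp_all)
      then show thesis by (rule that[OF tree_core.fork])
    next
      assume e: "e = S \<union> {d, v}"
      have "insert e E = {S \<union> {a, b}, S \<union> {b, c}, S \<union> {c, d}, S \<union> {d, v}}"
        unfolding E e by (simp add: insert_commute)
      then have "is_cone {{0,1},{1,2},{2,3},{3,4}} (insert e E)"
        by (intro is_cone_list[of "[a, b, c, d, v]" S]) (use dist v in simp_all)
      then show thesis by (rule that[OF tree_core.path4])
    qed
  next
    case True
    define R where "R = S - {u}"
    have S_eq: "S = insert u R" and R: "u \<notin> R" "R \<subseteq> S" using True by (auto simp: R_def)
    have u: "u \<notin> {a, b, c, d}" using True dist by blast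
    have dist': "distinct [a, b, c, d, u, v]" "distinct [v, u, d, c, b, a]" "{a, b, c, d, u, v} \<inter> R = {}"
      using dist v u neq R by auto
    have "e = R \<union> {a, b, v} \<or> e = R \<union> {b, c, v} \<or> e = R \<union> {c, d, v}"
      using E_elim f(4) u by (auto simp: R_def)
    then show thesis
    proof (elim disjE)
      assume e: "e = R \<union> {a, b, v}"
      have "insert e E = {R \<union> {v, a, b}, R \<union> {a, b, u}, R \<union> {b, u, c}, R \<union> {u, c, d}}"
        unfolding E e by (simp add: S_eq insert_commute)
      then have "is_cone {{0,1,2},{1,2,3},{2,3,4},{3,4,5}} (insert e E)"
        by (intro is_cone_list[of "[v, a, b, u, c, d]" R]) (use dist' in simp_all)
      then show thesis by (rule that[OF tree_core.tight_path])
    next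
      assume e: "e = R \<union> {b, c, v}"
      have "insert e E = {R \<union> {u, b, c}, R \<union> {u, b, a}, R \<union> {b, c, v}, R \<union> {u, c, d}}"
        unfolding E e by (simp add: S_eq insert_commute)
      then have "is_cone {{0,1,2},{0,1,3},{1,2,4},{0,2,5}} (insert e E)"
        by (intro is_cone_list[of "[u, b, c, a, v, d]" R]) (use dist' in simp_all)
      then show thesis by (rule that[OF tree_core.triangle])
    next
      assume e: "e = R \<union> {c, d, v}"
      have "insert e E = {R \<union> {v, d, c}, R \<union> {d, c, u}, R \<union> {c, u, b}, R \<union> {u, b, a}}"
        unfolding E e by (simp add: S_eq insert_commute)
      then have "is_cone {{0,1,2},{1,2,3},{2,3,4},{3,4,5}} (insert e E)"
        by (intro is_cone_list[of "[v, d, c, u, b, a]" R]) (use dist' in simp_all)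
      then show thesis by (rule that[OF tree_core.tight_path])
    qed
  qed
qed

text \<open>Follows the edge order: one or two edges form a star, three a star or a path, and one
  more attachment covers four.\<close>

lemma tight_tree_cone:
  assumes T: "tight_tree r T" and r: "1 \<le> r" and t: "card (edges T) = t" "t \<le> 4"
  obtains k P where "tree_core k t P" "is_cone P (edges T)"
proof -
  obtain es where es: "es \<noteq> []" "distinct es" "set es = edges T"
    and step: "\<And>i. 1 \<le> i \<Longrightarrow> i < length es \<Longrightarrow> attach (set (take i es)) (es ! i)"
    using tight_tree_order[OF T] by blast
  have len: "length es = t" using es t distinct_card by metis
  have take_Suc_set: "set (take (Suc i) es) = insert (es ! i) (set (take i es))" if "i < t" for i
    using that len by (simp add: take_Suc_conv_app_nth)
  have all: "set (take t es) = edges T" using es len by simp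
  have star1: "is_star 1 (set (take 1 es))"
  proof -
    have "r_graph r T" "es ! 0 \<in> edges T"
      using T es(1) nth_mem[of 0 es] unfolding es(3) by (auto simp: tight_tree_def)
    then have "card (es ! 0) = r" by (auto simp: r_graph_def)
    \<comment> \<open>The star needs a varying vertex, so \<open>1 \<le> r\<close> enters
      here.\<close>
    then obtain x where x: "x \<in> es ! 0" using r by (metis card.empty ex_in_conv not_one_le_zero)
    have "set (take 1 es) = {es ! 0}" using es(1) by (cases es) auto
    also have "\<dots> = (\<lambda>y. insert y (es ! 0 - {x})) ` {x}" using x by (auto simp: insert_absorb)
    finally have "set (take 1 es) = (\<lambda>y. insert y (es ! 0 - {x})) ` {x}" .
    moreover have "finite {x}" "card {x} = 1" "{x} \<inter> (es ! 0 - {x}) = {}" by auto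
    ultimately show ?thesis unfolding is_star_def by blast
  qed
  have star2: "is_star 2 (set (take 2 es))" if "2 \<le> t"
    using attach_star1[OF star1 step[of 1]] take_Suc_set[of 1] that len by (simp add: numeral_2_eq_2)
  have three: "is_star 3 (set (take 3 es)) \<or> is_path3 (set (take 3 es))" if "3 \<le> t"
    using attach_star2[OF star2 step[of 2]] take_Suc_set[of 2] that len by (simp add: numeral_3_eq_3 numeral_2_eq_2)
  have "1 \<le> t" using es(1) len by (cases es) auto
  then have star: "\<exists>k P. tree_core k t P \<and> is_cone P (edges T)" if "is_star t (edges T)"
    using tree_core.star is_star_cone[OF that] by blast
  from \<open>1 \<le> t\<close> consider "t = 1" | "t = 2" | "t = 3" | "t = 4" using t(2) by linarith
  then have "\<exists>k P. tree_core k t P \<and> is_cone P (edges T)"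
  proof cases
    case 1
    then show ?thesis using star star1 all by simp
  next
    case 2
    then show ?thesis using star star2 all by simp
  next
    case 3
    then have "is_star 3 (edges T) \<or> is_path3 (edges T)" using three all by simp
    then show ?thesis
      using 3 star tree_core.path3 is_path3_cone by blast
  next
    case 4
    let ?E = "set (take 3 es)"
    have edges: "edges T = insert (es ! 3) ?E" using take_Suc_set[of 3] all 4 by simp
    have att: "attach ?E (es ! 3)" using step[of 3] 4 len by simp
    have "is_star 3 ?E \<or> is_path3 ?E" using three 4 by simp
    then show ?thesis
    proof
      assume "is_star 3 ?E"
      then have "is_star 4 (edges T) \<or> is_cone {{0,1},{0,2},{0,3},{1,4}} (edges T)"
        using attach_star3[OF _ att] edges by simp
      then show ?thesis
        using 4 star tree_core.fork by blast
    next
      assume "is_path3 ?E"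
      then show ?thesis using attach_path3[OF _ att] edges 4 by metis
    qed
  qed
  then show thesis using that by blast
qed

section \<open>From the shadow bound to the Turan number\<close>

theorem theorem1p4:
  fixes n r t :: nat and T :: "'a hypergraph"
  assumes "2 \<le> r" and "r \<le> n"
    and "tight_tree r T"
    and "card (edges T) = t" and "t \<le> 4"
  shows "real (ex_number r n T) \<le> (real t - 1) / real r * real (n choose (r - 1))"
proof -
  have T: "r_graph r T" "verts T = \<Union>(edges T)" "edges T \<noteq> {}"
    using assms(3) by (auto simp: tight_tree_def)
  obtain k P where core: "tree_core k t P" and cone: "is_cone P (edges T)"
    using tight_tree_cone[OF assms(3) _ assms(4,5)] assms(1) by auto
  note P = tree_core_uniform[OF core]
  have k: "k \<le> r" using cone_uniformity[OF T(1) P(1,2) cone] by (metis le_add2)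
  \<comment> \<open>The set is finite and nonempty, so the maximum is attained by some extremal host
    \<open>G\<close>.\<close>
  have "ex_number r n T \<in> {card (edges G) | G :: nat hypergraph.
      r_graph r G \<and> card (verts G) = n \<and> \<not> contains G T}"
    unfolding ex_number_def using ex_number_set_nonempty[OF T(3)]
    by (intro Max_in finite_ex_number_set)
  then obtain G :: "nat hypergraph" where G: "r_graph r G" "card (verts G) = n" "\<not> contains G T"
    and ex: "ex_number r n T = card (edges G)"
    by blast
  have finG: "finite (verts G)" using G(1) by (simp add: r_graph_def)
  have "edges G \<subseteq> Pow (verts G)" using G(1) by (auto simp: r_graph_def)
  then have "finite (edges G)" using finG finite_subset by blast
  then have u: "uniform r (edges G)"
    using G(1) finG finite_subset unfolding uniform_def r_graph_def by blast
  have "r * card (edges G) \<le> (t - 1) * card (shadow (edges G))"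
  proof (rule shadow_bound_from_links[OF u P(3) k])
    fix S :: "nat set"
    assume S: "finite S" "card S + k = r"
    \<comment> \<open>A copy of \<open>P\<close> in this link would give a copy of \<open>T\<close>
      in \<open>G\<close>.\<close>
    show "k * card (link (edges G) S) \<le> (t - 1) * card (shadow (link (edges G) S))"
      using tree_core_bound[OF core uniform_link[OF u S]]
        cone_contained[OF T(1,2) P(1,2) cone G(1) S] G(3) by blast
  qed
  also have "card (shadow (edges G)) \<le> n choose (r - 1)"
  proof -
    have "shadow (edges G) \<subseteq> {f. f \<subseteq> verts G \<and> card f = r - 1}"
      using G(1) finG finite_subset by (fastforce simp: shadow_def r_graph_def)
    then have "card (shadow (edges G)) \<le> card {f. f \<subseteq> verts G \<and> card f = r - 1}"
      using finG by (intro card_mono) auto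
    then show ?thesis using n_subsets[OF finG] G(2) by simp
  qed
  finally have "r * card (edges G) \<le> (t - 1) * (n choose (r - 1))" by simp
  then have "real (r * card (edges G)) \<le> real ((t - 1) * (n choose (r - 1)))" by linarith
  \<comment> \<open>Ensures that the truncated \<open>t - 1\<close> on naturals agrees with the real
    one.\<close>
  moreover have "1 \<le> t"
  proof -
    have "finite (edges T)" using assms(3) by (metis tight_tree_order List.finite_set)
    then show ?thesis using T(3) assms(4) by (auto simp: Suc_le_eq card_gt_0_iff)
  qed
  ultimately show ?thesis
    using assms(1) by (simp add: ex of_nat_diff field_simps)
qed

end
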